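(* Let $Y=[0,1]^d$ with a probability measure $\mu$, let $\mathcal{L}^{\Delta}:Y\to\mathbb{R}$ be the (numerically approximated) parameters-to-observable map, let $N\in\mathbb{N}$, and for each training vector $\mathbf{S}\in Y^N$ let $\mathcal{L}^{\ast}(\cdot;\mathbf{S}):Y\to\mathbb{R}$ be the trained neural network produced from $\mathbf{S}$ by the deep learning algorithm described in the context. Let $\bar{\mathcal{E}}_G$, $\bar{\mathcal{E}}_T$ and $\mathcal{E}_{TV}$ be the cumulative generalization error, the cumulative training error and the validation gap defined in the context. Then $$ |\bar{\mathcal{E}}_G-\bar{\mathcal{E}}_T|\;\leq\;\mathcal{E}_{TV}+\sqrt{\frac{8\left(\mathbb{V}(\mathcal{L}^{\Delta})+\mathbb{V}(\mathcal{L}^{\ast})\right)}{N}}, $$ where $$ \mathbb{V}(\mathcal{L}^{\Delta})=\int_Y(\mathcal{L}^{\Delta}(y))^2\,d\mu(y)-\Big(\int_Y\mathcal{L}^{\Delta}(y)\,d\mu(y)\Big)^2, $$ $$ \mathbb{V}(\mathcal{L}^{\ast})=\int_Y\int_{Y^N}(\mathcal{L}^{\ast}(y;\mathbf{S}))^2\,d\mu^N(\mathbf{S})\,d\mu(y)-\Big(\int_Y\int_{Y^N}\mathcal{L}^{\ast}(y;\mathbf{S})\,d\mu^N(\mathbf{S})\,d\mu(y)\Big)^2 . $$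
   Context: **The map.** $\mathcal{L}^{\Delta}:Y\to\mathbb{R}$ is a given function assigning to a parameter $y\in Y$ the value of an observable (an integral functional of the solution) of a generic parametric PDE, computed by a numerical method at grid resolution $\Delta$. No structure of the PDE enters beyond the resulting function $\mathcal{L}^{\Delta}$. **Training vectors.** A training set of $N$ points drawn i.i.d. from $\mu$ is identified with a vector $\mathbf{S}=[y_1,\dots,y_N]\in Y^N$, distributed according to the product measure $\mu^N=\mu\otimes\cdots\otimes\mu$ on $Y^N$. **Deep learning algorithm.** Fix a feedforward architecture $\mathcal{L}_\theta(y)=C_K\circ\sigma\circ C_{K-1}\circ\cdots\circ\sigma\circ C_1(y)$, where $\sigma(z)=\max(z,0)$ acts componentwise, $C_k z=W_kz+b_k$ are affine maps (input dimension of $C_1$ equal to $d$, output dimension of $C_K$ equal to $1$), and $\theta=\{W_k,b_k\}_{k}\in\Theta\subset\mathbb{R}^M$. Given $\mathbf{S}$, a gradient descent type method is run to approximately minimize over $\theta\in\Theta$ the functional $\sum_{i=1}^N|\mathcal{L}^{\Delta}(y_i)-\mathcal{L}_\theta(y_i)|+\lambda\mathcal{R}(\theta)$, with $\lambda\ge 0$ and $\mathcal{R}:\Theta\to\mathbb{R}$ a regularization term. It returns a weight vector $\theta^{\ast}=\theta^{\ast}(\mathbf{S})$ (an approximate local minimum; no quantitative accuracy is assumed), and $\mathcal{L}^{\ast}(y;\mathbf{S}):=\mathcal{L}_{\theta^{\ast}(\mathbf{S})}(y)$. Thus $(y,\mathbf{S})\mapsto\mathcal{L}^{\ast}(y;\mathbf{S})$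 is a function on $Y\times Y^N$. **Integrability.** $\mathcal{L}^{\Delta}$ is measurable and square integrable with respect to $\mu$, and $\mathcal{L}^{\ast}$ is measurable and square integrable with respect to $\mu\otimes\mu^N$. **Errors.** The cumulative generalization error is $$\bar{\mathcal{E}}_G=\int_{Y^N}\int_Y|\mathcal{L}^{\Delta}(y)-\mathcal{L}^{\ast}(y;\mathbf{S})|\,d\mu(y)\,d\mu^N(\mathbf{S}).$$ The cumulative training error is $$\bar{\mathcal{E}}_T=\frac1N\int_{Y^N}\sum_{i=1}^N|\mathcal{L}^{\Delta}(y_i)-\mathcal{L}^{\ast}(y_i;\mathbf{S})|\,d\mu^N(\mathbf{S}),\qquad \mathbf{S}=[y_1,\dots,y_N].$$ Let $(\Omega,\Sigma,\mathbb{P})$ be a complete probability space and let the validation set $\{z_1,\dots,z_N\}$ consist of $N$ random points $z_j:\Omega\to Y$, i.i.d. with law $\mu$, chosen independently of the training sets. The cumulative validation error is the random variable $$\bar{\mathcal{E}}_V(\omega)=\frac1N\int_{Y^N}\sum_{j=1}^N|\mathcal{L}^{\Delta}(z_j(\omega))-\mathcal{L}^{\ast}(z_j(\omega);\mathbf{S})|\,d\mu^N(\mathbf{S}).$$ The validation gap is $$\mathcal{E}_{TV}=\mathbb{E}\big(|\bar{\mathcal{E}}_T-\bar{\mathcal{E}}_V|\big)=\int_\Omega|\bar{\mathcal{E}}_T-\bar{\mathcal{E}}_V(\omega)|\,d\mathbb{P}(\omega).$$ *)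

theory Defs
  imports "HOL-Probability.Probability"
begin

text \<open>
  Points of \<open>\<real>\<^sup>m\<close> are functions in \<^term>\<open>{..<m} \<rightarrow>\<^sub>E (UNIV :: real set)\<close>, and vectors of \<open>N\<close>
  sample points are functions \<^term>\<open>S\<close> with entries \<^term>\<open>S i\<close> for \<^prop>\<open>i < N\<close>.
  As the index set is finite, the product \<open>\<sigma>\<close>-algebra below is the Borel \<open>\<sigma>\<close>-algebra of
  \<open>[0,1]\<^sup>d\<close>; its space is \<^term>\<open>{..<d} \<rightarrow>\<^sub>E {0..1::real}\<close>.
\<close>

definition unit_cube :: "nat \<Rightarrow> (nat \<Rightarrow> real) measure" where
  "unit_cube d = PiM {..<d} (\<lambda>_. restrict_space borel {0..1})"

definition sample_measure :: "nat \<Rightarrow> 'a measure \<Rightarrow> (nat \<Rightarrow> 'a) measure" where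
  "sample_measure N \<mu> = PiM {..<N} (\<lambda>_. \<mu>)"


subsection \<open>Feedforward ReLU networks\<close>

text \<open>
  An architecture consists of a depth \<open>K\<close> and widths \<open>w 0, \<dots>, w K\<close>; the affine map \<open>C\<^sub>k\<close> goes from
  \<open>\<real>\<close> to the power \<open>w (k - 1)\<close> to \<open>\<real>\<close> to the power \<open>w k\<close>, for \<open>1 \<le> k \<le> K\<close>.
  The parameter space \<open>\<real>\<^sup>M\<close> has its \<open>M\<close> coordinates labelled by the entries of the matrices \<open>W\<^sub>k\<close>
  and of the vectors \<open>b\<^sub>k\<close>, so that \<open>M\<close> is the cardinality of \<open>param_index w K\<close>.
\<close>

datatype coord = Weight nat nat nat | Bias nat nat

type_synonym params = "coord \<Rightarrow> real"

definition param_index :: "(nat \<Rightarrow> nat) \<Rightarrow> nat \<Rightarrow> coord set" where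
  "param_index w K =
     {Weight k i j | k i j. 1 \<le> k \<and> k \<le> K \<and> i < w k \<and> j < w (k - 1)} \<union>
     {Bias k i | k i. 1 \<le> k \<and> k \<le> K \<and> i < w k}"

definition param_space :: "(nat \<Rightarrow> nat) \<Rightarrow> nat \<Rightarrow> params set" where
  "param_space w K = (param_index w K \<rightarrow>\<^sub>E UNIV)"

definition affine_layer ::
    "(nat \<Rightarrow> nat) \<Rightarrow> params \<Rightarrow> nat \<Rightarrow> (nat \<Rightarrow> real) \<Rightarrow> (nat \<Rightarrow> real)" where
  "affine_layer w \<theta> k x =
     (\<lambda>i\<in>{..<w k}. (\<Sum>j<w (k - 1). \<theta> (Weight k i j) * x j) + \<theta> (Bias k i))"

definition relu :: "nat \<Rightarrow> (nat \<Rightarrow> real) \<Rightarrow> (nat \<Rightarrow> real)" where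
  "relu m x = (\<lambda>i\<in>{..<m}. max (x i) 0)"

primrec hidden ::
    "(nat \<Rightarrow> nat) \<Rightarrow> params \<Rightarrow> nat \<Rightarrow> (nat \<Rightarrow> real) \<Rightarrow> (nat \<Rightarrow> real)" where
  "hidden w \<theta> 0 y = y"
| "hidden w \<theta> (Suc k) y = relu (w (Suc k)) (affine_layer w \<theta> (Suc k) (hidden w \<theta> k y))"

text \<open>For \<^prop>\<open>w K = (1::nat)\<close> the only output coordinate is the one with index \<open>0\<close>.\<close>

definition network :: "(nat \<Rightarrow> nat) \<Rightarrow> nat \<Rightarrow> params \<Rightarrow> (nat \<Rightarrow> real) \<Rightarrow> real" where
  "network w K \<theta> y = affine_layer w \<theta> K (hidden w \<theta> (K - 1) y) 0"


subsection \<open>Training\<close>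

definition training_loss ::
    "(nat \<Rightarrow> nat) \<Rightarrow> nat \<Rightarrow> nat \<Rightarrow> ((nat \<Rightarrow> real) \<Rightarrow> real) \<Rightarrow> real \<Rightarrow> (params \<Rightarrow> real)
      \<Rightarrow> (nat \<Rightarrow> nat \<Rightarrow> real) \<Rightarrow> params \<Rightarrow> real" where
  "training_loss w K N L lam R S \<theta> =
     (\<Sum>i<N. \<bar>L (S i) - network w K \<theta> (S i)\<bar>) + lam * R \<theta>"

text \<open>
  The optimiser comes without quantitative guarantees, hence the tolerance \<open>\<epsilon>\<close> and the radius \<open>\<delta>\<close>
  are arbitrary (and may depend on the training vector). Neighbourhoods are those of the maximum
  norm on \<open>\<real>\<^sup>M\<close>.
\<close>

definition approx_local_min ::
    "(nat \<Rightarrow> nat) \<Rightarrow> nat \<Rightarrow> params set \<Rightarrow> (params \<Rightarrow> real) \<Rightarrow> params \<Rightarrow> bool" where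
  "approx_local_min w K \<Theta> J \<theta> \<longleftrightarrow>
     \<theta> \<in> \<Theta> \<and>
     (\<exists>\<epsilon>\<ge>0. \<exists>\<delta>>0. \<forall>\<theta>'\<in>\<Theta>.
        (\<forall>p\<in>param_index w K. \<bar>\<theta>' p - \<theta> p\<bar> < \<delta>) \<longrightarrow> J \<theta> \<le> J \<theta>' + \<epsilon>)"

definition trained_network ::
    "(nat \<Rightarrow> nat) \<Rightarrow> nat \<Rightarrow> ((nat \<Rightarrow> nat \<Rightarrow> real) \<Rightarrow> params)
      \<Rightarrow> (nat \<Rightarrow> real) \<Rightarrow> (nat \<Rightarrow> nat \<Rightarrow> real) \<Rightarrow> real" where
  "trained_network w K \<theta>s y S = network w K (\<theta>s S) y"


subsection \<open>Errors and variances\<close>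

definition gen_error ::
    "'a measure \<Rightarrow> nat \<Rightarrow> ('a \<Rightarrow> real) \<Rightarrow> ('a \<Rightarrow> (nat \<Rightarrow> 'a) \<Rightarrow> real) \<Rightarrow> real" where
  "gen_error \<mu> N L Ls = (\<integral>S. (\<integral>y. \<bar>L y - Ls y S\<bar> \<partial>\<mu>) \<partial>sample_measure N \<mu>)"

definition train_error ::
    "'a measure \<Rightarrow> nat \<Rightarrow> ('a \<Rightarrow> real) \<Rightarrow> ('a \<Rightarrow> (nat \<Rightarrow> 'a) \<Rightarrow> real) \<Rightarrow> real" where
  "train_error \<mu> N L Ls =
     1 / real N * (\<integral>S. (\<Sum>i<N. \<bar>L (S i) - Ls (S i) S\<bar>) \<partial>sample_measure N \<mu>)"

text \<open>
  The training vector is integrated out against its own law, separately from the outcome \<open>\<omega>\<close> which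
  determines the validation points; this is how the validation set is independent of the
  training sets.
\<close>

definition val_error ::
    "'a measure \<Rightarrow> nat \<Rightarrow> ('a \<Rightarrow> real) \<Rightarrow> ('a \<Rightarrow> (nat \<Rightarrow> 'a) \<Rightarrow> real)
      \<Rightarrow> (nat \<Rightarrow> 'w \<Rightarrow> 'a) \<Rightarrow> 'w \<Rightarrow> real" where
  "val_error \<mu> N L Ls z \<omega> =
     1 / real N * (\<integral>S. (\<Sum>j<N. \<bar>L (z j \<omega>) - Ls (z j \<omega>) S\<bar>) \<partial>sample_measure N \<mu>)"

definition val_gap ::
    "'w measure \<Rightarrow> 'a measure \<Rightarrow> nat \<Rightarrow> ('a \<Rightarrow> real) \<Rightarrow> ('a \<Rightarrow> (nat \<Rightarrow> 'a) \<Rightarrow> real)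
      \<Rightarrow> (nat \<Rightarrow> 'w \<Rightarrow> 'a) \<Rightarrow> real" where
  "val_gap P \<mu> N L Ls z = (\<integral>\<omega>. \<bar>train_error \<mu> N L Ls - val_error \<mu> N L Ls z \<omega>\<bar> \<partial>P)"

definition var_observable :: "'a measure \<Rightarrow> ('a \<Rightarrow> real) \<Rightarrow> real" where
  "var_observable \<mu> L = (\<integral>y. (L y)\<^sup>2 \<partial>\<mu>) - (\<integral>y. L y \<partial>\<mu>)\<^sup>2"

definition var_trained ::
    "'a measure \<Rightarrow> nat \<Rightarrow> ('a \<Rightarrow> (nat \<Rightarrow> 'a) \<Rightarrow> real) \<Rightarrow> real" where
  "var_trained \<mu> N Ls =
     (\<integral>y. (\<integral>S. (Ls y S)\<^sup>2 \<partial>sample_measure N \<mu>) \<partial>\<mu>) -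
     (\<integral>y. (\<integral>S. Ls y S \<partial>sample_measure N \<mu>) \<partial>\<mu>)\<^sup>2"

end

theory Submission
  imports Defs
begin

text \<open>
  Averaging the pointwise error over the training vector leaves a deterministic function of a
  single point, \<open>G y = \<integral>S. \<bar>L y - Ls y S\<bar>\<close>. Because the training vector is integrated out, \<open>G\<close> does
  not depend on the validation points. By Fubini the cumulative generalization error is the mean
  of \<open>G\<close> under \<open>\<mu>\<close>, and the cumulative validation error is almost surely the sample mean of \<open>G\<close>
  over the \<open>N\<close> i.i.d. validation points. The triangle inequality, with the validation error as
  the intermediate value, therefore bounds the gap between generalization and training error by
  the validation gap plus the mean Monte Carlo error for \<open>G\<close>, which is at most the square root of
  \<open>Var G / N\<close> (\<open>sample_mean_deviation_le\<close>). The training error enters only as a constant, so the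
  dependence between the network and its own training points is never an obstacle.

  It remains to bound the variance of \<open>G\<close>. Regard \<open>X = L y - Ls y S\<close> as a random variable on the
  product of the two probability spaces. Averaging over \<open>S\<close> cannot increase the variance
  (\<open>variance_average_le\<close>), nor can taking absolute values (\<open>variance_abs_le\<close>), and the variance of
  a difference is at most twice the sum of the variances (\<open>variance_diff_le\<close>). Hence
  \<open>Var G \<le> Var \<bar>X\<bar> \<le> Var X \<le> 2 (Var L + Var Ls)\<close>, which gives the estimate with the factor \<open>2\<close>
  (\<open>gen_train_gap_le\<close>) and a fortiori with the factor \<open>8\<close>.
\<close>

section \<open>Second moments\<close>

context prob_space
begin

lemma expectation_square_le:
  fixes X :: "'a \<Rightarrow> real"
  assumes [measurable]: "X \<in> borel_measurable M" and "integrable M (\<lambda>x. (X x)\<^sup>2)"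
  shows "(expectation X)\<^sup>2 \<le> expectation (\<lambda>x. (X x)\<^sup>2)"
proof -
  have "integrable M X"
    using assms by (rule square_integrable_imp_integrable)
  then show ?thesis
    using variance_eq[of X] variance_positive[of X] assms by simp
qed

lemma expectation_abs_le_sqrt:
  fixes X :: "'a \<Rightarrow> real"
  assumes [measurable]: "X \<in> borel_measurable M" and "integrable M (\<lambda>x. (X x)\<^sup>2)"
  shows "expectation (\<lambda>x. \<bar>X x\<bar>) \<le> sqrt (expectation (\<lambda>x. (X x)\<^sup>2))"
  using expectation_square_le[of "\<lambda>x. \<bar>X x\<bar>"] assms by (intro real_le_rsqrt) simp

lemma square_integrable_diff:
  fixes X Y :: "'a \<Rightarrow> real"
  assumes [measurable]: "X \<in> borel_measurable M" "Y \<in> borel_measurable M"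
    and "integrable M (\<lambda>x. (X x)\<^sup>2)" "integrable M (\<lambda>x. (Y x)\<^sup>2)"
  shows "integrable M (\<lambda>x. (X x - Y x)\<^sup>2)"
proof (rule Bochner_Integration.integrable_bound)
  show "integrable M (\<lambda>x. 2 * (X x)\<^sup>2 + 2 * (Y x)\<^sup>2)"
    using assms by auto
  show "AE x in M. norm ((X x - Y x)\<^sup>2) \<le> norm (2 * (X x)\<^sup>2 + 2 * (Y x)\<^sup>2)"
  proof (rule AE_I2)
    fix x
    have "(X x - Y x)\<^sup>2 \<le> 2 * (X x)\<^sup>2 + 2 * (Y x)\<^sup>2"
      using zero_le_power2[of "X x + Y x"] by (simp add: power2_sum power2_diff)
    then show "norm ((X x - Y x)\<^sup>2) \<le> norm (2 * (X x)\<^sup>2 + 2 * (Y x)\<^sup>2)"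
      by simp
  qed
qed simp

text \<open>
  After centring, this is the pointwise inequality \<open>(a - b)\<^sup>2 \<le> 2 a\<^sup>2 + 2 b\<^sup>2\<close>. It avoids the
  covariance, on which there is no information for an observable and the network fitted to it.
\<close>

lemma variance_diff_le:
  fixes X Y :: "'a \<Rightarrow> real"
  assumes [measurable]: "X \<in> borel_measurable M" "Y \<in> borel_measurable M"
    and X: "integrable M (\<lambda>x. (X x)\<^sup>2)" and Y: "integrable M (\<lambda>x. (Y x)\<^sup>2)"
  shows "variance (\<lambda>x. X x - Y x) \<le> 2 * (variance X + variance Y)"
proof -
  have int: "integrable M X" "integrable M Y"
    using X Y by (auto intro: square_integrable_imp_integrable)
  have intc: "integrable M (\<lambda>x. (X x - expectation X)\<^sup>2)" "integrable M (\<lambda>x. (Y x - expectation Y)\<^sup>2)"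
    using X Y by (auto intro!: square_integrable_diff)
  have "variance (\<lambda>x. X x - Y x)
      = expectation (\<lambda>x. ((X x - expectation X) - (Y x - expectation Y))\<^sup>2)"
    using int by (simp add: algebra_simps)
  also have "\<dots> \<le> expectation (\<lambda>x. 2 * (X x - expectation X)\<^sup>2 + 2 * (Y x - expectation Y)\<^sup>2)"
  proof (rule integral_mono)
    show "integrable M (\<lambda>x. ((X x - expectation X) - (Y x - expectation Y))\<^sup>2)"
      using intc by (auto intro!: square_integrable_diff)
    show "integrable M (\<lambda>x. 2 * (X x - expectation X)\<^sup>2 + 2 * (Y x - expectation Y)\<^sup>2)"
      using intc by auto
    have "(a - b)\<^sup>2 \<le> 2 * a\<^sup>2 + 2 * b\<^sup>2" for a b :: real
      using zero_le_power2[of "a + b"] by (simp add: power2_sum power2_diff)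
    then show "((X x - expectation X) - (Y x - expectation Y))\<^sup>2
        \<le> 2 * (X x - expectation X)\<^sup>2 + 2 * (Y x - expectation Y)\<^sup>2" for x .
  qed
  also have "\<dots> = 2 * (variance X + variance Y)"
    using intc by simp
  finally show ?thesis .
qed

text \<open>
  Taking absolute values keeps the second moment and can only enlarge the square of the mean.
\<close>

lemma variance_abs_le:
  fixes X :: "'a \<Rightarrow> real"
  assumes [measurable]: "X \<in> borel_measurable M" and X: "integrable M (\<lambda>x. (X x)\<^sup>2)"
  shows "variance (\<lambda>x. \<bar>X x\<bar>) \<le> variance X"
proof -
  have int: "integrable M X"
    using X by (auto intro: square_integrable_imp_integrable)
  have "\<bar>expectation X\<bar> \<le> \<bar>expectation (\<lambda>x. \<bar>X x\<bar>)\<bar>"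
    using integral_abs_bound[of M X] by linarith
  then have "(expectation X)\<^sup>2 \<le> (expectation (\<lambda>x. \<bar>X x\<bar>))\<^sup>2"
    by (rule abs_le_square_iff[THEN iffD1])
  then show ?thesis
    using int X by (simp add: variance_eq)
qed

text \<open>
  Independent centred variables are orthogonal in \<open>L\<^sup>2\<close>, so Pythagoras gives additivity.
\<close>

lemma expectation_square_sum_indep:
  fixes X :: "'i \<Rightarrow> 'a \<Rightarrow> real"
  assumes "finite I" "indep_vars (\<lambda>_. borel) X I"
    and "\<And>i. i \<in> I \<Longrightarrow> integrable M (\<lambda>x. (X i x)\<^sup>2)"
    and "\<And>i. i \<in> I \<Longrightarrow> expectation (X i) = 0"
  shows "integrable M (\<lambda>x. (\<Sum>i\<in>I. X i x)\<^sup>2) \<and>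
    expectation (\<lambda>x. (\<Sum>i\<in>I. X i x)\<^sup>2) = (\<Sum>i\<in>I. expectation (\<lambda>x. (X i x)\<^sup>2))"
  using assms
proof (induction I rule: finite_induct)
  case empty
  then show ?case by simp
next
  case (insert i I)
  let ?S = "\<lambda>x. \<Sum>j\<in>I. X j x"
  have rv [measurable]: "X j \<in> borel_measurable M" if "j \<in> insert i I" for j
    using insert.prems(1) that unfolding indep_vars_def by blast
  have int: "integrable M (X j)" if "j \<in> insert i I" for j
    using that rv insert.prems(2) by (auto intro: square_integrable_imp_integrable)
  have S: "integrable M ?S"
    using int by auto
  have IH: "integrable M (\<lambda>x. (?S x)\<^sup>2)"
      "expectation (\<lambda>x. (?S x)\<^sup>2) = (\<Sum>j\<in>I. expectation (\<lambda>x. (X j x)\<^sup>2))"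
    using insert.IH insert.prems indep_vars_subset[OF insert.prems(1), of I] by auto
  have indep: "indep_var borel (X i) borel ?S"
    using insert.hyps insert.prems(1) by (intro indep_vars_sum) auto
  have cross: "integrable M (\<lambda>x. X i x * ?S x)" "expectation (\<lambda>x. X i x * ?S x) = 0"
    using indep_var_integrable[OF indep] indep_var_lebesgue_integral[OF indep] int S
      insert.prems(3) by auto
  have "(\<Sum>j\<in>insert i I. X j x)\<^sup>2 = (X i x)\<^sup>2 + (?S x)\<^sup>2 + 2 * (X i x * ?S x)" for x
    using insert.hyps by (simp add: power2_sum)
  then show ?case
    using insert.hyps insert.prems(2) IH cross by simp
qed

end

section \<open>Averaging over one factor of a product space\<close>

text \<open>
  Jensen on slices: on almost every slice the square of the average is at most the average of
  the square, and Fubini integrates the slices.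
\<close>

lemma (in pair_prob_space) square_integrable_average:
  fixes f :: "'a \<times> 'b \<Rightarrow> real"
  assumes [measurable]: "f \<in> borel_measurable (M1 \<Otimes>\<^sub>M M2)"
    and f: "integrable (M1 \<Otimes>\<^sub>M M2) (\<lambda>p. (f p)\<^sup>2)"
  shows "integrable M1 (\<lambda>x. (\<integral>y. f (x, y) \<partial>M2)\<^sup>2)"
    and "(\<integral>x. (\<integral>y. f (x, y) \<partial>M2)\<^sup>2 \<partial>M1) \<le> (\<integral>p. (f p)\<^sup>2 \<partial>(M1 \<Otimes>\<^sub>M M2))"
proof -
  have AE: "AE x in M1. (\<integral>y. f (x, y) \<partial>M2)\<^sup>2 \<le> (\<integral>y. (f (x, y))\<^sup>2 \<partial>M2)"
    using AE_integrable_fst'[OF f] AE_space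
    by eventually_elim (auto intro!: M2.expectation_square_le)
  have int: "integrable M1 (\<lambda>x. \<integral>y. (f (x, y))\<^sup>2 \<partial>M2)"
    by (rule integrable_fst'[OF f])
  show int': "integrable M1 (\<lambda>x. (\<integral>y. f (x, y) \<partial>M2)\<^sup>2)"
  proof (rule Bochner_Integration.integrable_bound[OF int])
    show "AE x in M1. norm ((\<integral>y. f (x, y) \<partial>M2)\<^sup>2) \<le> norm (\<integral>y. (f (x, y))\<^sup>2 \<partial>M2)"
      using AE by eventually_elim simp
  qed simp
  show "(\<integral>x. (\<integral>y. f (x, y) \<partial>M2)\<^sup>2 \<partial>M1) \<le> (\<integral>p. (f p)\<^sup>2 \<partial>(M1 \<Otimes>\<^sub>M M2))"
    unfolding integral_fst'[OF f, symmetric] using int' int AE by (rule integral_mono_AE)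
qed

text \<open>
  One half of the law of total variance: the average has the same mean as \<open>f\<close> and a second moment
  that is no larger.
\<close>

lemma (in pair_prob_space) variance_average_le:
  fixes f :: "'a \<times> 'b \<Rightarrow> real"
  assumes [measurable]: "f \<in> borel_measurable (M1 \<Otimes>\<^sub>M M2)"
    and f: "integrable (M1 \<Otimes>\<^sub>M M2) (\<lambda>p. (f p)\<^sup>2)"
  shows "M1.variance (\<lambda>x. \<integral>y. f (x, y) \<partial>M2) \<le> P.variance f"
proof -
  have int: "integrable (M1 \<Otimes>\<^sub>M M2) f"
    using f by (auto intro: P.square_integrable_imp_integrable)
  have "integrable M1 (\<lambda>x. \<integral>y. f (x, y) \<partial>M2)"
    by (rule integrable_fst'[OF int])
  then have "M1.variance (\<lambda>x. \<integral>y. f (x, y) \<partial>M2)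
      = (\<integral>x. (\<integral>y. f (x, y) \<partial>M2)\<^sup>2 \<partial>M1) - (integral\<^sup>L (M1 \<Otimes>\<^sub>M M2) f)\<^sup>2"
    using M1.variance_eq square_integrable_average(1)[OF assms] integral_fst'[OF int] by metis
  also have "\<dots> \<le> P.variance f"
    using square_integrable_average(2)[OF assms] int f by (simp add: P.variance_eq)
  finally show ?thesis .
qed

section \<open>Averages over independent samples\<close>

text \<open>
  The Monte Carlo rate. The centred samples are independent with variance \<open>Var g\<close>, so the mean
  square of the deviation is \<open>Var g / N\<close>; the \<open>L\<^sup>1\<close> norm is at most the \<open>L\<^sup>2\<close> norm.
\<close>

lemma (in prob_space) sample_mean_deviation_le:
  fixes g :: "'b \<Rightarrow> real" and z :: "nat \<Rightarrow> 'a \<Rightarrow> 'b"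
  assumes N: "N \<ge> 1"
    and [measurable]: "g \<in> borel_measurable \<mu>" and g: "integrable \<mu> (\<lambda>y. (g y)\<^sup>2)"
    and \<mu>: "prob_space \<mu>"
    and indep: "indep_vars (\<lambda>_. \<mu>) z {..<N}"
    and law: "\<And>j. j < N \<Longrightarrow> distr M \<mu> (z j) = \<mu>"
  shows "expectation (\<lambda>\<omega>. \<bar>integral\<^sup>L \<mu> g - 1 / real N * (\<Sum>j<N. g (z j \<omega>))\<bar>)
    \<le> sqrt (prob_space.variance \<mu> g / real N)"
proof -
  interpret \<mu>: prob_space \<mu> by fact
  define m where "m = integral\<^sup>L \<mu> g"
  define V where "V = \<mu>.variance g"
  let ?X = "\<lambda>j \<omega>. g (z j \<omega>) - m"
  have z [measurable]: "z j \<in> measurable M \<mu>" if "j < N" for j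
    using indep that by (simp add: indep_vars_def)
  have gi: "integrable \<mu> g"
    using g by (auto intro: \<mu>.square_integrable_imp_integrable)
  have gm: "integrable \<mu> (\<lambda>y. (g y - m)\<^sup>2)"
    using g by (auto intro!: \<mu>.square_integrable_diff)
  have transfer: "integrable M (\<lambda>\<omega>. h (z j \<omega>))" "expectation (\<lambda>\<omega>. h (z j \<omega>)) = integral\<^sup>L \<mu> h"
    if "integrable \<mu> h" "j < N" for h :: "'b \<Rightarrow> real" and j
    using that integrable_distr_eq[OF z[OF \<open>j < N\<close>], of h] integral_distr[OF z[OF \<open>j < N\<close>], of h]
      law[OF \<open>j < N\<close>] by auto
  have iX: "indep_vars (\<lambda>_. borel) ?X {..<N}"
    by (rule indep_vars_compose2[OF indep]) simp
  have sqX: "integrable M (\<lambda>\<omega>. (?X j \<omega>)\<^sup>2)" "expectation (\<lambda>\<omega>. (?X j \<omega>)\<^sup>2) = V" if "j < N" for j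
    using transfer[OF gm that] by (simp_all add: V_def m_def)
  have zero: "expectation (?X j) = 0" if "j < N" for j
    using transfer[of "\<lambda>y. g y - m", OF _ that] gi by (simp add: m_def \<mu>.prob_space)
  have sum: "integrable M (\<lambda>\<omega>. (\<Sum>j<N. ?X j \<omega>)\<^sup>2)"
      "expectation (\<lambda>\<omega>. (\<Sum>j<N. ?X j \<omega>)\<^sup>2) = real N * V"
    using expectation_square_sum_indep[OF _ iX] sqX zero by auto
  have eq: "m - 1 / real N * (\<Sum>j<N. g (z j \<omega>)) = - 1 / real N * (\<Sum>j<N. ?X j \<omega>)" for \<omega>
    using N by (simp add: sum_subtractf field_simps)
  have sqeq: "(m - 1 / real N * (\<Sum>j<N. g (z j \<omega>)))\<^sup>2 = (1 / real N)\<^sup>2 * (\<Sum>j<N. ?X j \<omega>)\<^sup>2" for \<omega>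
    unfolding eq by (simp add: power_divide)
  have "expectation (\<lambda>\<omega>. \<bar>m - 1 / real N * (\<Sum>j<N. g (z j \<omega>))\<bar>)
      \<le> sqrt (expectation (\<lambda>\<omega>. (m - 1 / real N * (\<Sum>j<N. g (z j \<omega>)))\<^sup>2))"
  proof (rule expectation_abs_le_sqrt)
    show "integrable M (\<lambda>\<omega>. (m - 1 / real N * (\<Sum>j<N. g (z j \<omega>)))\<^sup>2)"
      unfolding sqeq using sum(1) by simp
  qed auto
  also have "\<dots> = sqrt (V / real N)"
    unfolding sqeq using sum(2) N by (simp add: power2_eq_square)
  finally show ?thesis
    by (simp add: m_def V_def)
qed

section \<open>The generalization gap\<close>

lemma prob_space_sample_measure: "prob_space \<mu> \<Longrightarrow> prob_space (sample_measure N \<mu>)"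
  unfolding sample_measure_def by (intro prob_space_PiM) auto

text \<open>
  The Monte Carlo estimate is applied to the error averaged over the training vector, and the
  variance of that average is traced back to the two given variances. Their nonnegativity is part
  of the conclusion so that the constant can be enlarged afterwards.
\<close>

lemma (in prob_space) gen_train_gap_le:
  fixes L :: "'b \<Rightarrow> real" and Ls :: "'b \<Rightarrow> (nat \<Rightarrow> 'b) \<Rightarrow> real" and z :: "nat \<Rightarrow> 'a \<Rightarrow> 'b"
  assumes N: "N \<ge> 1"
    and \<mu>: "prob_space \<mu>"
    and L [measurable]: "L \<in> borel_measurable \<mu>" and L2: "integrable \<mu> (\<lambda>y. (L y)\<^sup>2)"
    and Ls [measurable]: "(\<lambda>(y, S). Ls y S) \<in> borel_measurable (\<mu> \<Otimes>\<^sub>M sample_measure N \<mu>)"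
    and Ls2: "integrable (\<mu> \<Otimes>\<^sub>M sample_measure N \<mu>) (\<lambda>(y, S). (Ls y S)\<^sup>2)"
    and indep: "indep_vars (\<lambda>_. \<mu>) z {..<N}"
    and law: "\<And>j. j < N \<Longrightarrow> distr M \<mu> (z j) = \<mu>"
  shows "0 \<le> var_observable \<mu> L" "0 \<le> var_trained \<mu> N Ls"
    and "\<bar>gen_error \<mu> N L Ls - train_error \<mu> N L Ls\<bar>
      \<le> val_gap M \<mu> N L Ls z + sqrt (2 * (var_observable \<mu> L + var_trained \<mu> N Ls) / real N)"
proof -
  define Q where "Q = sample_measure N \<mu>"
  note [folded Q_def, measurable] = Ls
  note Ls2 = Ls2[folded Q_def]
  interpret \<mu>: prob_space \<mu> by fact
  interpret Q: prob_space Q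
    unfolding Q_def by (rule prob_space_sample_measure) fact
  interpret pair: pair_prob_space \<mu> Q ..
  let ?L = "\<lambda>p. L (fst p)" and ?Ls = "\<lambda>p. Ls (fst p) (snd p)"
  define G where "G y = (\<integral>S. \<bar>L y - Ls y S\<bar> \<partial>Q)" for y

  have [measurable]: "?Ls \<in> borel_measurable (\<mu> \<Otimes>\<^sub>M Q)"
    using Ls unfolding Q_def by (simp add: case_prod_beta)
  have L2': "integrable (\<mu> \<Otimes>\<^sub>M Q) (\<lambda>p. (?L p)\<^sup>2)"
  proof (rule pair.Fubini_integrable)
    show "integrable \<mu> (\<lambda>y. \<integral>S. norm ((?L (y, S))\<^sup>2) \<partial>Q)"
      using L2 by (simp add: Q.prob_space)
  qed auto
  have Ls2': "integrable (\<mu> \<Otimes>\<^sub>M Q) (\<lambda>p. (?Ls p)\<^sup>2)"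
    using Ls2 by (simp add: case_prod_beta')
  have Lsi: "integrable (\<mu> \<Otimes>\<^sub>M Q) ?Ls"
    using Ls2' by (auto intro: pair.square_integrable_imp_integrable)
  have D2: "integrable (\<mu> \<Otimes>\<^sub>M Q) (\<lambda>p. (?L p - ?Ls p)\<^sup>2)"
    using L2' Ls2' by (intro pair.square_integrable_diff) auto
  have Di: "integrable (\<mu> \<Otimes>\<^sub>M Q) (\<lambda>p. \<bar>?L p - ?Ls p\<bar>)"
    by (rule integrable_abs, rule pair.square_integrable_imp_integrable[OF _ D2]) simp

  \<comment> \<open>Both variances become variances on the product space, where \<open>variance_diff_le\<close> can combine
    them.\<close>
  have fst: "integral\<^sup>L (\<mu> \<Otimes>\<^sub>M Q) (\<lambda>p. h (fst p)) = integral\<^sup>L \<mu> h"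
    if "integrable (\<mu> \<Otimes>\<^sub>M Q) (\<lambda>p. h (fst p))" for h :: "'b \<Rightarrow> real"
    using pair.integral_fst'[OF that] by (simp add: Q.prob_space)
  have Li': "integrable (\<mu> \<Otimes>\<^sub>M Q) ?L"
    using L2' by (auto intro: pair.square_integrable_imp_integrable)
  have vL: "var_observable \<mu> L = pair.variance ?L"
    unfolding var_observable_def pair.variance_eq[OF Li' L2'] by (simp add: fst[OF Li'] fst[OF L2'])
  have vLs: "var_trained \<mu> N Ls = pair.variance ?Ls"
    unfolding var_trained_def pair.variance_eq[OF Lsi Ls2'] Q_def[symmetric]
    using pair.integral_fst'[OF Lsi] pair.integral_fst'[OF Ls2'] by simp
  show "0 \<le> var_observable \<mu> L" "0 \<le> var_trained \<mu> N Ls"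
    unfolding vL vLs by (rule pair.variance_positive)+

  have Gm [measurable]: "G \<in> borel_measurable \<mu>"
    unfolding G_def[abs_def] by measurable
  have G2: "integrable \<mu> (\<lambda>y. (G y)\<^sup>2)"
    using pair.square_integrable_average(1)[of "\<lambda>p. \<bar>?L p - ?Ls p\<bar>"] D2
    by (simp add: G_def[abs_def])
  have Gi: "integrable \<mu> G"
    using G2 by (auto intro: \<mu>.square_integrable_imp_integrable)
  have "\<mu>.variance G \<le> pair.variance (\<lambda>p. \<bar>?L p - ?Ls p\<bar>)"
    using pair.variance_average_le[of "\<lambda>p. \<bar>?L p - ?Ls p\<bar>"] D2 by (simp add: G_def[abs_def])
  also have "\<dots> \<le> pair.variance (\<lambda>p. ?L p - ?Ls p)"
    using D2 by (intro pair.variance_abs_le) auto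
  also have "\<dots> \<le> 2 * (var_observable \<mu> L + var_trained \<mu> N Ls)"
    unfolding vL vLs using L2' Ls2' by (intro pair.variance_diff_le) auto
  finally have varG: "\<mu>.variance G \<le> 2 * (var_observable \<mu> L + var_trained \<mu> N Ls)" .

  have gen: "gen_error \<mu> N L Ls = integral\<^sup>L \<mu> G"
    unfolding gen_error_def Q_def[symmetric] G_def
    by (rule pair.Fubini_integral) (use Di in \<open>simp add: case_prod_beta'\<close>)

  have z [measurable]: "z j \<in> measurable M \<mu>" if "j < N" for j
    using indep that by (simp add: indep_vars_def)
  \<comment> \<open>The sum and the integral in the validation error can be exchanged when every summand is
    integrable in the training vector. This holds for almost every evaluation point, and the law
    of the validation points carries it over to almost every outcome.\<close>
  have slice: "AE y in \<mu>. integrable Q (\<lambda>S. \<bar>L y - Ls y S\<bar>)"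
    using pair.AE_integrable_fst'[OF Di] by simp
  have slice_z: "AE \<omega> in M. \<forall>j\<in>{..<N}. integrable Q (\<lambda>S. \<bar>L (z j \<omega>) - Ls (z j \<omega>) S\<bar>)"
  proof (rule AE_finite_allI)
    fix j assume "j \<in> {..<N}"
    then have j: "j < N" by simp
    show "AE \<omega> in M. integrable Q (\<lambda>S. \<bar>L (z j \<omega>) - Ls (z j \<omega>) S\<bar>)"
      by (rule AE_distrD[OF z[OF j]]) (unfold law[OF j], rule slice)
  qed simp
  have val: "AE \<omega> in M. val_error \<mu> N L Ls z \<omega> = 1 / real N * (\<Sum>j<N. G (z j \<omega>))"
    using slice_z by eventually_elim (simp add: val_error_def G_def Q_def[symmetric])
  have valm [measurable]: "val_error \<mu> N L Ls z \<in> borel_measurable M"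
    unfolding val_error_def[abs_def] Q_def[symmetric] by measurable
  have Gz: "integrable M (\<lambda>\<omega>. G (z j \<omega>))" if "j < N" for j
    using integrable_distr_eq[OF z[OF that], of G] law[OF that] Gi by simp
  have vali: "integrable M (val_error \<mu> N L Ls z)"
  proof -
    have "integrable M (\<lambda>\<omega>. 1 / real N * (\<Sum>j<N. G (z j \<omega>)))"
      using Gz by (intro integrable_mult_right Bochner_Integration.integrable_sum) simp
    then show ?thesis
      using integrable_cong_AE[OF valm _ val] by auto
  qed

  let ?g = "gen_error \<mu> N L Ls" and ?t = "train_error \<mu> N L Ls" and ?v = "val_error \<mu> N L Ls z"
  have "\<bar>?g - ?t\<bar> = expectation (\<lambda>\<omega>. \<bar>?g - ?t\<bar>)"
    by (simp add: prob_space)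
  also have "\<dots> \<le> expectation (\<lambda>\<omega>. \<bar>?t - ?v \<omega>\<bar> + \<bar>?g - ?v \<omega>\<bar>)"
    using vali by (intro integral_mono) auto
  also have "\<dots> = val_gap M \<mu> N L Ls z + expectation (\<lambda>\<omega>. \<bar>?g - ?v \<omega>\<bar>)"
    using vali by (simp add: val_gap_def)
  also have "expectation (\<lambda>\<omega>. \<bar>?g - ?v \<omega>\<bar>)
      = expectation (\<lambda>\<omega>. \<bar>integral\<^sup>L \<mu> G - 1 / real N * (\<Sum>j<N. G (z j \<omega>))\<bar>)"
  proof (rule integral_cong_AE)
    show "AE \<omega> in M. \<bar>?g - ?v \<omega>\<bar> = \<bar>integral\<^sup>L \<mu> G - 1 / real N * (\<Sum>j<N. G (z j \<omega>))\<bar>"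
      using val by eventually_elim (simp add: gen)
  qed measurable
  also have "\<dots> \<le> sqrt (\<mu>.variance G / real N)"
    using N Gm G2 \<mu> indep law by (rule sample_mean_deviation_le)
  also have "\<dots> \<le> sqrt (2 * (var_observable \<mu> L + var_trained \<mu> N Ls) / real N)"
    using varG by (intro real_sqrt_le_mono divide_right_mono) auto
  finally show "\<bar>?g - ?t\<bar>
      \<le> val_gap M \<mu> N L Ls z + sqrt (2 * (var_observable \<mu> L + var_trained \<mu> N Ls) / real N)"
    by simp
qed

theorem lemma2p2:
  fixes d N K :: nat
    and \<mu> :: "(nat \<Rightarrow> real) measure"
    and L :: "(nat \<Rightarrow> real) \<Rightarrow> real"
    and w :: "nat \<Rightarrow> nat"
    and \<Theta> :: "params set"
    and lam :: real
    and R :: "params \<Rightarrow> real"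
    and \<theta>s :: "(nat \<Rightarrow> nat \<Rightarrow> real) \<Rightarrow> params"
    and P :: "'w measure"
    and z :: "nat \<Rightarrow> 'w \<Rightarrow> (nat \<Rightarrow> real)"
  assumes N: "N \<ge> 1"
    and \<mu>: "prob_space \<mu>" "sets \<mu> = sets (unit_cube d)"
    and architecture: "K \<ge> 1" "w 0 = d" "w K = 1" "\<Theta> \<subseteq> param_space w K"
    and lam: "lam \<ge> 0"
    and training: "\<And>S. S \<in> space (sample_measure N \<mu>) \<Longrightarrow>
          approx_local_min w K \<Theta> (training_loss w K N L lam R S) (\<theta>s S)"
    and L_square_integrable:
          "L \<in> borel_measurable \<mu>"
          "integrable \<mu> (\<lambda>y. (L y)\<^sup>2)"
    and trained_square_integrable:
          "(\<lambda>(y, S). trained_network w K \<theta>s y S)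
             \<in> borel_measurable (\<mu> \<Otimes>\<^sub>M sample_measure N \<mu>)"
          "integrable (\<mu> \<Otimes>\<^sub>M sample_measure N \<mu>) (\<lambda>(y, S). (trained_network w K \<theta>s y S)\<^sup>2)"
    and P: "prob_space P" "complete_measure P"
    and validation_iid:
          "prob_space.indep_vars P (\<lambda>_. \<mu>) z {..<N}"
          "\<And>j. j < N \<Longrightarrow> distr P \<mu> (z j) = \<mu>"
  shows "\<bar>gen_error \<mu> N L (trained_network w K \<theta>s) - train_error \<mu> N L (trained_network w K \<theta>s)\<bar>
      \<le> val_gap P \<mu> N L (trained_network w K \<theta>s) z
        + sqrt (8 * (var_observable \<mu> L + var_trained \<mu> N (trained_network w K \<theta>s)) / real N)"
proof -
  interpret P: prob_space P by fact
  let ?Ls = "trained_network w K \<theta>s"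
  note gap = P.gen_train_gap_le[OF N \<mu>(1) L_square_integrable trained_square_integrable
      validation_iid]
  have "sqrt (2 * (var_observable \<mu> L + var_trained \<mu> N ?Ls) / real N)
      \<le> sqrt (8 * (var_observable \<mu> L + var_trained \<mu> N ?Ls) / real N)"
    using gap(1,2) by (intro real_sqrt_le_mono divide_right_mono mult_right_mono) auto
  with gap(3) show ?thesis
    by linarith
qed

end
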